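(* Let $X\ne\{0\}$ be an $F$-space. If $\mathcal{A}$ is the family of subsets of $\mathbb{Z}_+$ with upper Banach density equal to $1$, then $X$ does not support an $\mathcal{A}$-frequently hypercyclic operator; that is, no continuous linear operator $T$ on $X$ is $\mathcal{A}$-frequently hypercyclic.
   Context: $\mathbb{Z}_+$ is the set of non-negative integers. An $F$-space is a topological vector space whose topology is induced by a complete translation-invariant metric. For $A\subseteq\mathbb{Z}_+$, let $\alpha^s=\limsup_{k\to\infty}|A\cap[k+1,k+s]|$; the upper Banach density of $A$ is $\overline{Bd}(A)=\lim_{s\to\infty}\alpha^s/s$ (the limit always exists). For a continuous linear operator $T$ on $X$, $x\in X$ and $V\subset X$, $N(x,V)=\{n\ge0:T^nx\in V\}$. $T$ is $\mathcal{A}$-frequently hypercyclic if there exists $x\in X$ such that $N(x,V)\in\mathcal{A}$ for every non-empty open set $V\subset X$. *)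

theory Defs
  imports "HOL-Analysis.Analysis"
begin

text \<open>
  The scalar field ranges over the class \<open>real_normed_field\<close>, whose instances are, up to
  isomorphism, exactly the real and the complex numbers (Gelfand--Mazur), so that real and
  complex F-spaces are treated uniformly. The metric is only required to exist; it is not part
  of the structure.
\<close>

locale F_space = vector_space scale
  for scale :: "'k::real_normed_field \<Rightarrow> 'a::topological_ab_group_add \<Rightarrow> 'a" +
  assumes continuous_scale: "continuous_on UNIV (\<lambda>(c, x). scale c x)"
    and complete_invariant_metric:
      "\<exists>d. Metric_space UNIV d \<and>
           Metric_space.mtopology UNIV d = (euclidean :: 'a topology) \<and>
           Metric_space.mcomplete UNIV d \<and>
           (\<forall>x y z. d (x + z) (y + z) = d x y)"

definition upper_Banach_density :: "nat set \<Rightarrow> ereal" where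
  "upper_Banach_density A =
     lim (\<lambda>s. limsup (\<lambda>k. ereal (real (card (A \<inter> {k + 1..k + s})))) / ereal (real s))"

definition return_set :: "('a \<Rightarrow> 'a) \<Rightarrow> 'a \<Rightarrow> 'a set \<Rightarrow> nat set" where
  "return_set T x V = {n. (T ^^ n) x \<in> V}"

definition frequently_hypercyclic ::
    "nat set set \<Rightarrow> ('a::topological_space \<Rightarrow> 'a) \<Rightarrow> bool" where
  "frequently_hypercyclic \<A> T \<longleftrightarrow>
     (\<exists>x. \<forall>V. open V \<and> V \<noteq> {} \<longrightarrow> return_set T x V \<in> \<A>)"

end

theory Submission
  imports Defs
begin

text \<open>
  A non-empty open set \<open>V\<close> whose visits by the orbit of \<open>x\<close> never occur at two consecutive times
  has a return set of upper Banach density at most \<open>1/2\<close>, because each window of length two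
  contains at most one return time. Such a \<open>V\<close> exists for every continuous self-map \<open>T\<close> of a
  Hausdorff space with more than one point, whatever \<open>x\<close> is
  (\<open>exists_open_return_set_nonconsecutive\<close>): if \<open>T\<close> moves some point \<open>y\<close>, then a small
  neighbourhood \<open>V\<close> of \<open>y\<close> is disjoint from \<open>T ` V\<close>; otherwise \<open>T\<close> is the identity, and the
  constant orbit of \<open>x\<close> misses every \<open>V\<close> that does not contain \<open>x\<close>.

  Reading off the density from windows of length two needs the existence of the limit
  \<open>lim \<alpha>\<^sup>s / s\<close>, since \<open>lim\<close> is an unspecified value on divergent sequences. Counting in
  adjacent windows shows that \<open>\<alpha>\<^sup>s\<close> is subadditive in \<open>s\<close>, so Fekete's lemma gives
  convergence to the infimum of \<open>\<alpha>\<^sup>s / s\<close> over \<open>s \<ge> 1\<close>; in particular each single \<open>\<alpha>\<^sup>s / s\<close>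
  bounds the density from above (\<open>upper_Banach_density_le\<close>).
\<close>

lemma subadditive_mult_add_le:
  fixes a :: "nat \<Rightarrow> real"
  assumes "\<And>m n. a (m + n) \<le> a m + a n"
  shows "a (q * m + r) \<le> real q * a m + a r"
proof (induction q)
  case (Suc q)
  have "a (Suc q * m + r) \<le> a m + a (q * m + r)"
    using assms[of m "q * m + r"] by (simp add: add.assoc)
  with Suc show ?case by (simp add: algebra_simps)
qed simp

text \<open>
  Fekete's lemma. Division of \<open>n\<close> by a fixed \<open>m\<close> writes \<open>a n\<close> as at most \<open>n / m\<close> copies of \<open>a m\<close>
  plus a remainder that stays bounded, so \<open>a n / n\<close> is eventually not much larger than
  \<open>a m / m\<close>, for every choice of \<open>m\<close>.
\<close>

lemma subadditive_tendsto_Inf: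
  fixes a :: "nat \<Rightarrow> real"
  assumes sub: "\<And>m n. a (m + n) \<le> a m + a n" and nonneg: "\<And>n. 0 \<le> a n"
  shows "(\<lambda>n. a n / real n) \<longlonglongrightarrow> (INF n\<in>{1..}. a n / real n)"
proof (rule order_tendstoI)
  let ?L = "INF n\<in>{1..}. a n / real n"
  have bdd: "bdd_below ((\<lambda>n. a n / real n) ` {1..})"
    by (rule bdd_belowI2[of _ 0]) (simp add: nonneg)
  fix l assume l: "l < ?L"
  have "l < a n / real n" if "n \<ge> 1" for n
    using cINF_lower[OF bdd, of n] that l by simp
  then show "\<forall>\<^sub>F n in sequentially. l < a n / real n"
    by (intro eventually_sequentiallyI)
next
  let ?L = "INF n\<in>{1..}. a n / real n"
  fix u assume "?L < u"
  then obtain m where m: "m \<ge> 1" "a m / real m < u"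
    by (subst (asm) cINF_less_iff) (auto intro!: bdd_belowI2[of _ 0] simp: nonneg)
  define C where "C = (\<Sum>r<m. a r)"
  have upper: "a n / real n \<le> a m / real m + C / real n" if "n \<ge> 1" for n
  proof -
    have "a n \<le> real (n div m) * a m + a (n mod m)"
      using subadditive_mult_add_le[of a "n div m" m "n mod m", OF sub] by simp
    also have "real (n div m) * a m \<le> real n / real m * a m"
      by (intro mult_right_mono nonneg of_nat_div_le_of_nat)
    also have "a (n mod m) \<le> C"
      unfolding C_def using m by (intro member_le_sum) (auto simp: nonneg)
    finally show ?thesis using that m by (simp add: field_simps)
  qed
  have "(\<lambda>n. a m / real m + C / real n) \<longlonglongrightarrow> a m / real m + 0"
    by (intro tendsto_intros lim_const_over_n)
  then have "\<forall>\<^sub>F n in sequentially. a m / real m + C / real n < u"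
    using m by (intro order_tendstoD(2)) auto
  then show "\<forall>\<^sub>F n in sequentially. a n / real n < u"
    using eventually_ge_at_top[of 1]
    by eventually_elim (use upper in force)
qed

text \<open>A window of length \<open>s + t\<close> is a window of length \<open>s\<close> followed by one of length \<open>t\<close>; the
  latter starts at \<open>k + s\<close> instead of \<open>k\<close>, which the upper limit does not see.\<close>

lemma limsup_window_count_add_le:
  fixes A :: "nat set"
  defines "c \<equiv> \<lambda>s k. ereal (real (card (A \<inter> {k + 1..k + s})))"
  shows "limsup (c (s + t)) \<le> limsup (c s) + limsup (c t)"
proof -
  have "c (s + t) k \<le> c s k + c t (k + s)" for k
  proof -
    have "A \<inter> {k + 1..k + (s + t)} = (A \<inter> {k + 1..k + s}) \<union> (A \<inter> {k + s + 1..k + s + t})"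
      by auto
    then show ?thesis
      unfolding c_def by (simp flip: of_nat_add add: card_Un_le)
  qed
  then have "limsup (c (s + t)) \<le> limsup (\<lambda>k. c s k + c t (k + s))"
    by (intro Limsup_mono) simp
  also have "\<dots> \<le> limsup (c s) + limsup (\<lambda>k. c t (k + s))"
    by (rule ereal_limsup_add_mono)
  also have "limsup (\<lambda>k. c t (k + s)) = limsup (c t)"
    by (rule limsup_shift_k)
  finally show ?thesis .
qed

lemma upper_Banach_density_le:
  assumes count: "\<And>k. card (A \<inter> {k + 1..k + s}) \<le> b" and "s > 0"
  shows "upper_Banach_density A \<le> ereal (real b / real s)"
proof -
  define c where "c \<equiv> \<lambda>s k. ereal (real (card (A \<inter> {k + 1..k + s})))"
  define a where "a \<equiv> \<lambda>s. real_of_ereal (limsup (c s))"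
  have nonneg: "0 \<le> limsup (c s)" for s
    by (rule le_Limsup) (auto simp: c_def)
  have le: "limsup (c s) \<le> ereal (real s)" for s
  proof (rule Limsup_bounded, rule always_eventually, rule allI)
    fix k
    have "card (A \<inter> {k + 1..k + s}) \<le> card {k + 1..k + s}"
      by (intro card_mono) auto
    then show "c s k \<le> ereal (real s)" by (simp add: c_def)
  qed
  have "\<bar>limsup (c s)\<bar> \<noteq> \<infinity>" for s
    using nonneg[of s] le[of s] by (cases "limsup (c s)") auto
  then have c_a: "limsup (c s) = ereal (a s)" for s
    unfolding a_def by (simp add: ereal_real)
  have a_nonneg: "0 \<le> a s" for s
    using nonneg[of s] by (simp add: c_a)
  have "limsup (c (s + t)) \<le> limsup (c s) + limsup (c t)" for s t
    unfolding c_def by (rule limsup_window_count_add_le)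
  then have "a (s + t) \<le> a s + a t" for s t
    by (simp add: c_a)
  note lim_a = subadditive_tendsto_Inf[OF this a_nonneg]
  let ?L = "INF n\<in>{1..}. a n / real n"
  have "(\<lambda>n. limsup (c n) / ereal (real n)) \<longlonglongrightarrow> ereal ?L"
  proof (rule Lim_transform_eventually)
    show "(\<lambda>n. ereal (a n / real n)) \<longlonglongrightarrow> ereal ?L"
      using lim_a by simp
    show "\<forall>\<^sub>F n in sequentially. ereal (a n / real n) = limsup (c n) / ereal (real n)"
      using eventually_gt_at_top[of 0] by eventually_elim (simp add: c_a)
  qed
  then have "upper_Banach_density A = ereal ?L"
    unfolding upper_Banach_density_def c_def by (rule limI)
  moreover have "?L \<le> a s / real s"
    using \<open>s > 0\<close> by (intro cINF_lower bdd_belowI2[of _ 0]) (auto simp: a_nonneg)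
  moreover have "limsup (c s) \<le> ereal (real b)"
    using count by (intro Limsup_bounded always_eventually) (simp add: c_def)
  then have "a s / real s \<le> real b / real s"
    by (simp add: c_a divide_right_mono)
  ultimately show ?thesis by simp
qed

lemma upper_Banach_density_nonconsecutive:
  assumes "\<And>n. \<not> (n \<in> A \<and> Suc n \<in> A)"
  shows "upper_Banach_density A \<le> ereal (1 / 2)"
proof -
  have "card (A \<inter> {k + 1..k + 2}) \<le> 1" for k
  proof -
    have "{k + 1..k + 2} = {Suc k, Suc (Suc k)}" by auto
    with assms[of "Suc k"] show ?thesis by (auto simp: Int_insert_right)
  qed
  from upper_Banach_density_le[OF this] show ?thesis by simp
qed

lemma exists_open_return_set_nonconsecutive:
  fixes T :: "'a::topological_space \<Rightarrow> 'a"
  assumes haus: "Hausdorff_space (euclidean :: 'a topology)"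
    and cont: "continuous_on UNIV T" and "z \<noteq> x"
  shows "\<exists>V. open V \<and> V \<noteq> {} \<and>
    (\<forall>n. \<not> (n \<in> return_set T x V \<and> Suc n \<in> return_set T x V))"
proof -
  have sep: "\<exists>U W. open U \<and> open W \<and> u \<in> U \<and> w \<in> W \<and> U \<inter> W = {}" if "u \<noteq> w" for u w :: 'a
    using haus that by (simp add: Hausdorff_space_def disjnt_def)
  show ?thesis
  proof (cases "\<exists>y. T y \<noteq> y")
    case True
    then obtain y U W where UW: "open U" "open W" "y \<in> U" "T y \<in> W" "U \<inter> W = {}"
      using sep by metis
    \<comment> \<open>Points of \<open>V\<close> are sent into \<open>W\<close>, hence out of \<open>V\<close>.\<close>
    let ?V = "U \<inter> T -` W"
    have "open ?V"
      using UW cont by (intro open_Int open_vimage) auto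
    moreover have "y \<in> ?V" using UW by simp
    moreover have "\<not> (n \<in> return_set T x ?V \<and> Suc n \<in> return_set T x ?V)" for n
      using UW(5) by (auto simp: return_set_def)
    ultimately show ?thesis by blast
  next
    case False
    then have "(T ^^ n) x = x" for n by (induction n) auto
    moreover obtain V U where "open V" "z \<in> V" "x \<in> U" "V \<inter> U = {}"
      using sep[OF \<open>z \<noteq> x\<close>] by blast
    ultimately show ?thesis by (auto simp: return_set_def intro!: exI[of _ V])
  qed
qed

theorem proposition16:
  fixes scale :: "'k::real_normed_field \<Rightarrow> 'a::topological_ab_group_add \<Rightarrow> 'a"
  assumes "F_space scale"
    and "(UNIV :: 'a set) \<noteq> {0}"
  shows "\<not> (\<exists>T. Vector_Spaces.linear scale scale T \<and> continuous_on UNIV T \<and>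
              frequently_hypercyclic {A. upper_Banach_density A = 1} T)"
proof
  assume "\<exists>T. Vector_Spaces.linear scale scale T \<and> continuous_on UNIV T \<and>
              frequently_hypercyclic {A. upper_Banach_density A = 1} T"
  then obtain T :: "'a \<Rightarrow> 'a" and x where cont: "continuous_on UNIV T"
    and dense: "\<And>V. open V \<Longrightarrow> V \<noteq> {} \<Longrightarrow> upper_Banach_density (return_set T x V) = 1"
    unfolding frequently_hypercyclic_def by blast
  obtain d :: "'a \<Rightarrow> 'a \<Rightarrow> real" where "Metric_space UNIV d"
    and "Metric_space.mtopology UNIV d = euclidean"
    using F_space.complete_invariant_metric[OF assms(1)] by blast
  then have haus: "Hausdorff_space (euclidean :: 'a topology)"
    using Metric_space.Hausdorff_space_mtopology[of UNIV d] by simp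
  obtain z where "z \<noteq> x"
    using assms(2) by (metis UNIV_I UNIV_eq_I singleton_iff)
  from exists_open_return_set_nonconsecutive[OF haus cont this]
  obtain V where "open V" "V \<noteq> {}"
    and "\<And>n. \<not> (n \<in> return_set T x V \<and> Suc n \<in> return_set T x V)"
    by blast
  then have "1 \<le> ereal (1 / 2)"
    using dense upper_Banach_density_nonconsecutive[of "return_set T x V"] by metis
  then show False
    by (simp add: one_ereal_def)
qed

end
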